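(* Let $B$ be a tree, let $H$ be the corona of $B$, and let $n$ be the order (number of vertices) of $H$. Then $c_4(H) = n/2 + 1$.
   Context: All graphs are finite, simple and undirected. A coloring of a graph assigns a color to each vertex and need not be proper. A subgraph (not necessarily induced) is rainbow if all its vertices receive pairwise different colors. $P_4$ is the path on $4$ vertices. $c_4(G)$ is the maximum number of different colors used in a (not necessarily proper) coloring of the vertices of $G$ having no rainbow subgraph isomorphic to $P_4$. The corona of a graph is obtained by taking the graph (called the core) and, for each vertex $w$ of it, adding one new vertex (called a foot) adjacent only to $w$; this doubles the number of vertices. The one-vertex tree is allowed as the core, and its corona is $K_2$. *)

theory Defs
  imports Complex_Main "Graph_Theory.Graph_Theory"
begin

text \<open>
  A finite simple undirected graph is a \<^locale>\<open>pair_graph\<close>: a finite, symmetric, loop-free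
  relation on a finite vertex set, in which an edge is a pair of opposite arcs.

  The library's \<^const>\<open>tree\<close> is unsuitable for such graphs, because there every edge already
  yields a directed cycle of length 2. The cycles of the undirected graph are the directed
  cycles of length at least 3. Note that \<^const>\<open>connected\<close> excludes the null graph.
\<close>
definition undirected_tree :: "'a pair_pre_digraph \<Rightarrow> bool" where
  "undirected_tree G \<longleftrightarrow>
     pair_graph G \<and> connected (with_proj G) \<and> (\<nexists>p. pre_digraph.cycle (with_proj G) p \<and> length p \<ge> 3)"

text \<open>The core is the copy of \<open>B\<close> under \<^const>\<open>Inl\<close>; the foot of \<open>Inl w\<close> is \<open>Inr w\<close>.\<close>
definition corona :: "'a pair_pre_digraph \<Rightarrow> ('a + 'a) pair_pre_digraph" where
  "corona B = \<lparr> pverts = Inl ` pverts B \<union> Inr ` pverts B,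
     parcs = {(Inl u, Inl v) | u v. (u, v) \<in> parcs B}
       \<union> {(Inl w, Inr w) | w. w \<in> pverts B}
       \<union> {(Inr w, Inl w) | w. w \<in> pverts B} \<rparr>"

definition path_graph :: "nat \<Rightarrow> nat pair_pre_digraph" where
  "path_graph k = \<lparr> pverts = {0..<k},
     parcs = {(i, j). i < k \<and> j < k \<and> (j = Suc i \<or> i = Suc j)} \<rparr>"

definition rainbow :: "('a \<Rightarrow> 'c) \<Rightarrow> 'a pair_pre_digraph \<Rightarrow> bool" where
  "rainbow c S \<longleftrightarrow> inj_on c (pverts S)"

definition no_rainbow_P4 :: "'a pair_pre_digraph \<Rightarrow> ('a \<Rightarrow> 'c) \<Rightarrow> bool" where
  "no_rainbow_P4 G c \<longleftrightarrow>
     (\<nexists>S :: 'a pair_pre_digraph. subgraph (with_proj S) (with_proj G)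
        \<and> digraph_iso (with_proj S) (with_proj (path_graph 4)) \<and> rainbow c S)"

text \<open>
  Natural numbers suffice as colors of a finite graph. The numbers of colors considered form a
  finite nonempty set, by the two lemmas below, so that \<^const>\<open>Max\<close> is meaningful.
\<close>
definition c4 :: "'a pair_pre_digraph \<Rightarrow> nat" where
  "c4 G = Max {card (c ` pverts G) | c :: 'a \<Rightarrow> nat. no_rainbow_P4 G c}"

lemma finite_c4_set:
  fixes G :: "'a pair_pre_digraph"
  assumes "finite (pverts G)"
  shows "finite {card (c ` pverts G) | c :: 'a \<Rightarrow> nat. no_rainbow_P4 G c}"
  by (rule finite_subset[of _ "{..card (pverts G)}"]) (auto intro: card_image_le assms)

lemma c4_set_nonempty:
  fixes G :: "'a pair_pre_digraph"
  shows "{card (c ` pverts G) | c :: 'a \<Rightarrow> nat. no_rainbow_P4 G c} \<noteq> {}"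
proof -
  have "\<not> rainbow (\<lambda>_. 0 :: nat) S" if iso: "digraph_iso (with_proj S) (with_proj (path_graph 4))"
    for S :: "'a pair_pre_digraph"
  proof
    assume "rainbow (\<lambda>_. 0 :: nat) S"
    then have one: "x = y" if "x \<in> pverts S" "y \<in> pverts S" for x y
      using that by (simp add: rainbow_def inj_on_def)
    from iso obtain f where "with_proj (path_graph 4) = app_iso f (with_proj S)"
      by (auto simp: digraph_iso_def)
    then have "pverts (path_graph 4) = iso_verts f ` pverts S"
      by (metis verts_app_iso with_proj_simps(1))
    then have *: "{0..<4} = iso_verts f ` pverts S"
      by (simp add: path_graph_def)
    have "0 \<in> iso_verts f ` pverts S" "1 \<in> iso_verts f ` pverts S"
      unfolding *[symmetric] by simp_all
    then obtain x y where "x \<in> pverts S" "iso_verts f x = 0" "y \<in> pverts S" "iso_verts f y = 1"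
      by (metis imageE)
    with one[of x y] show False by simp
  qed
  then have "no_rainbow_P4 G (\<lambda>_. 0 :: nat)"
    by (auto simp: no_rainbow_P4_def)
  then show ?thesis by blast
qed

lemma pair_graph_corona:
  assumes "pair_graph B"
  shows "pair_graph (corona B)"
proof -
  interpret pair_graph B by fact
  have s: "(v, u) \<in> parcs B" if "(u, v) \<in> parcs B" for u v
    using that pair_sym_arcs by (auto simp: symmetric_def dest: symD)
  have w: "u \<in> pverts B \<and> v \<in> pverts B \<and> u \<noteq> v" if "(u, v) \<in> parcs B" for u v
    using that in_arcsD1 in_arcsD2 pair_no_loops by fastforce
  have fin: "finite (pverts (corona B))"
    by (simp add: corona_def)
  have sub: "parcs (corona B) \<subseteq> pverts (corona B) \<times> pverts (corona B)"
    using w by (auto simp: corona_def)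
  show ?thesis
  proof
    show "finite (parcs (corona B))"
      using fin sub finite_subset by blast
    show "symmetric (with_proj (corona B))"
      unfolding symmetric_def by (rule symI) (auto simp: corona_def dest: s)
  qed (use fin sub w in \<open>auto simp: corona_def\<close>)
qed

end

theory Submission
  imports Defs
begin

text \<open>
  Coloring the whole core with one color and all feet differently attains the bound, since the
  two inner vertices of a \<open>P\<^sub>4\<close> in a corona lie in the core.

  Conversely, argue by induction on the core. If deleting some core edge leaves two parts whose
  coronas share a color, the bounds for the two parts add up to the desired one. Otherwise the
  color sets \<open>{f x, g x}\<close> of core vertices \<open>x\<close> with their feet are pairwise disjoint. Then at
  most one of them has two elements: let \<open>x \<noteq> y\<close> be two such vertices and \<open>x, u, \<dots>, y\<close> the
  path joining them. If \<open>u = y\<close>, then \<open>x\<close>, \<open>y\<close> and their feet form a rainbow \<open>P\<^sub>4\<close>; else so do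
  \<open>x\<close>, its foot, \<open>u\<close> and the next vertex.
\<close>

section \<open>Rainbow copies of \<open>path_graph 4\<close> as walks\<close>

text \<open>Four different colors force four different vertices, so a rainbow walk with three arcs
  is a path. What remains is to pass between such walks and isomorphic copies of
  \<open>path_graph 4\<close>.\<close>

lemma no_rainbow_P4_iff:
  fixes G :: "'a pair_pre_digraph" and k :: "'a \<Rightarrow> 'c"
  assumes "pair_graph G"
  shows "no_rainbow_P4 G k \<longleftrightarrow>
    (\<forall>a b c d. (a, b) \<in> parcs G \<longrightarrow> (b, c) \<in> parcs G \<longrightarrow> (c, d) \<in> parcs G \<longrightarrow>
       \<not> distinct [k a, k b, k c, k d])"
proof
  interpret pair_graph G by fact
  have sym: "(v, u) \<in> parcs G" if "(u, v) \<in> parcs G" for u v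
    using that pair_sym_arcs by (auto simp: symmetric_def dest: symD)
  assume nr: "no_rainbow_P4 G k"
  show "\<forall>a b c d. (a, b) \<in> parcs G \<longrightarrow> (b, c) \<in> parcs G \<longrightarrow> (c, d) \<in> parcs G \<longrightarrow>
       \<not> distinct [k a, k b, k c, k d]"
  proof (intro allI impI notI)
    fix a b c d
    assume arcs: "(a, b) \<in> parcs G" "(b, c) \<in> parcs G" "(c, d) \<in> parcs G"
      and dist: "distinct [k a, k b, k c, k d]"
    define h where "h = (\<lambda>i::nat. [a, b, c, d] ! i)"
    \<comment> \<open>The arcs are only those along the walk; the induced subgraph could contain
      chords.\<close>
    define S where "S = \<lparr> pverts = h ` {0..<4}, parcs = map_prod h h ` parcs (path_graph 4) \<rparr>"
    define f where "f = \<lparr> iso_verts = h, iso_arcs = map_prod h h, iso_head = snd, iso_tail = fst \<rparr>"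
    have four: "{0..<4::nat} = {0, 1, 2, 3}" by auto
    have vals: "h 0 = a" "h (Suc 0) = b" "h 2 = c" "h 3 = d"
      by (simp_all add: h_def numeral_eq_Suc)
    have inj: "inj_on h {0..<4}"
      using dist unfolding four by (auto simp: vals)
    have parcs_P4: "parcs (path_graph 4) = {(0,1), (1,0), (1,2), (2,1), (2,3), (3,2)}"
      by (auto simp: path_graph_def)
    have wf_P4: "wf_digraph (with_proj (path_graph 4))"
      by unfold_locales (auto simp: path_graph_def)
    have "pre_digraph.digraph_isomorphism (with_proj (path_graph 4)) f"
      unfolding pre_digraph.digraph_isomorphism_def
    proof (intro conjI ballI)
      show "inj_on (iso_verts f) (verts (with_proj (path_graph 4)))"
        using inj by (simp add: f_def path_graph_def)
      have "inj_on (map_prod h h) ({0..<4} \<times> {0..<4})"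
        using inj by (simp add: map_prod_inj_on)
      then have "inj_on (map_prod h h) (parcs (path_graph 4))"
        by (rule inj_on_subset) (auto simp: path_graph_def)
      then show "inj_on (iso_arcs f) (arcs (with_proj (path_graph 4)))"
        by (simp add: f_def)
    qed (use wf_P4 in \<open>auto simp: f_def\<close>)
    moreover have "app_iso f (with_proj (path_graph 4)) = with_proj S"
      by (simp add: app_iso_def f_def S_def with_proj_def path_graph_def)
    \<comment> \<open>\<open>digraph_iso\<close> asks for a map from \<open>S\<close> to the
      standard path, hence the inverse of \<open>f\<close>.\<close>
    ultimately have "digraph_iso (with_proj S) (with_proj (path_graph 4))"
      unfolding digraph_iso_def
      by (metis pre_digraph.app_iso_inv wf_P4 wf_digraph.digraph_isomorphism_invI)
    moreover have "wf_digraph (with_proj S)"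
      by unfold_locales (auto simp: S_def path_graph_def)
    then have "subgraph (with_proj S) (with_proj G)"
      using arcs wf_digraph_axioms
      by (auto simp: subgraph_def compatible_def S_def four parcs_P4 vals in_arcsD1 in_arcsD2 sym)
    moreover have "rainbow k S"
      using dist by (auto simp: rainbow_def S_def four vals)
    ultimately show False
      using nr by (auto simp: no_rainbow_P4_def)
  qed
next
  assume paths: "\<forall>a b c d. (a, b) \<in> parcs G \<longrightarrow> (b, c) \<in> parcs G \<longrightarrow> (c, d) \<in> parcs G \<longrightarrow>
       \<not> distinct [k a, k b, k c, k d]"
  show "no_rainbow_P4 G k"
    unfolding no_rainbow_P4_def
  proof (intro notI, elim exE conjE)
    fix S
    assume S: "subgraph (with_proj S) (with_proj G)"
      and iso: "digraph_iso (with_proj S) (with_proj (path_graph 4))" and rb: "rainbow k S"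
    from iso obtain f where f: "pre_digraph.digraph_isomorphism (with_proj S) f"
      and P4: "with_proj (path_graph 4) = app_iso f (with_proj S)"
      by (auto simp: digraph_iso_def)
    have inj: "inj_on (iso_verts f) (pverts S)"
      using pre_digraph.digraph_isomorphism_inj_on_verts[OF f] by simp
    have verts: "iso_verts f ` pverts S = {0..<4}"
      using arg_cong[OF P4, of verts] by (simp add: path_graph_def)
    define g where "g = the_inv_into (pverts S) (iso_verts f)"
    have g_vert: "g i \<in> pverts S" and fg: "iso_verts f (g i) = i" if "i < 4" for i
      using that inj verts
      by (auto simp: g_def f_the_inv_into_f intro!: the_inv_into_into[OF _ _ subset_refl])
    have gf: "g (iso_verts f x) = x" if "x \<in> pverts S" for x
      using that inj by (simp add: g_def the_inv_into_f_f)
    have wfS: "wf_digraph (with_proj S)" and sub: "parcs S \<subseteq> parcs G"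
      using S by (auto simp: subgraph_def)
    have arc: "(g i, g (Suc i)) \<in> parcs G" if "Suc i < 4" for i
    proof -
      have "(i, Suc i) \<in> iso_arcs f ` parcs S"
        using that arg_cong[OF P4, of arcs] by (auto simp: path_graph_def)
      then obtain x y where xy: "(x, y) \<in> parcs S" "iso_arcs f (x, y) = (i, Suc i)"
        by force
      \<comment> \<open>An isomorphism may change the tail and head functions. Here both graphs use
        the projections, so the vertex map determines the image of each arc.\<close>
      moreover have "iso_tail f = fst" "iso_head f = snd"
        using arg_cong[OF P4, of tail] arg_cong[OF P4, of head] by simp_all
      ultimately have "iso_verts f x = i" "iso_verts f y = Suc i"
        using pre_digraph.iso_verts_tail[OF f, of "(x, y)"] pre_digraph.iso_verts_head[OF f, of "(x, y)"]
        by simp_all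
      moreover have "x \<in> pverts S" "y \<in> pverts S"
        using wf_digraph.wellformed[OF wfS, of "(x, y)"] xy by simp_all
      ultimately show ?thesis
        using xy sub gf by force
    qed
    have "k (g i) \<noteq> k (g j)" if "i < 4" "j < 4" "i \<noteq> j" for i j
      using that rb g_vert fg by (metis inj_onD rainbow_def)
    then have "distinct [k (g 0), k (g 1), k (g 2), k (g 3)]"
      by simp
    then show False
      using paths[rule_format, of "g 0" "g 1" "g 2" "g 3"] arc[of 0] arc[of 1] arc[of 2]
      by (simp add: numeral_eq_Suc)
  qed
qed

section \<open>Connectivity and bridges in trees\<close>

lemma undirected_tree_connected:
  assumes "undirected_tree B" "x \<in> pverts B" "y \<in> pverts B"
  shows "(x, y) \<in> (parcs B)\<^sup>*"
proof -
  interpret pair_graph B using assms by (simp add: undirected_tree_def)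
  have "strongly_connected (with_proj B)"
    using assms symmetric_connected_imp_strongly_connected pair_sym_arcs
    by (simp add: undirected_tree_def)
  then have "reachable (with_proj B) x y"
    using assms by auto
  then show ?thesis
    by (auto simp: reachable_def dest: rtrancl_on_rtranclI)
qed

text \<open>A path from \<open>v\<close> to \<open>u\<close> avoiding the edge would close up with
  \<open>(u, v)\<close> to a cycle. It has at least two arcs, since loops are excluded and
  \<open>(v, u)\<close> is deleted, so the cycle is long enough to contradict
  \<open>undirected_tree\<close>.\<close>

lemma undirected_tree_bridge:
  assumes "undirected_tree B" and uv: "(u, v) \<in> parcs B"
  shows "(v, u) \<notin> (parcs B - {(u, v), (v, u)})\<^sup>*"
proof
  interpret pair_graph B using assms by (simp add: undirected_tree_def)
  define C where "C = \<lparr> pverts = pverts B, parcs = parcs B - {(u, v), (v, u)} \<rparr>"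
  interpret C: pair_wf_digraph C
    by unfold_locales (auto simp: C_def in_arcsD1 in_arcsD2)
  assume path: "(v, u) \<in> (parcs B - {(u, v), (v, u)})\<^sup>*"
  have "reachable (with_proj C) v u"
    using path
  proof (induction rule: rtrancl_induct)
    case base
    then show ?case using in_arcsD2[OF uv] by (simp add: C_def reachable_def)
  next
    case (step y z)
    then have "(y, z) \<in> parcs C" by (simp add: C_def)
    then show ?case using step.IH C.reachable_adj_trans by blast
  qed
  then obtain p where "C.apath v p u"
    using C.reachable_apath by blast
  then have p: "set p \<subseteq> parcs B - {(u, v), (v, u)}" "pcas v p u" "distinct (pawalk_verts v p)"
    by (simp_all add: C.apath_def C.awalk_def) (simp add: C_def)
  have "cycle ((u, v) # p)"
    using p uv in_arcsD1[OF uv]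
    by (simp add: cycle_def awalk_def) blast
  moreover have "length ((u, v) # p) \<ge> 3"
  proof (cases p)
    case Nil
    then have "u = v" using p by simp
    then show ?thesis using pair_no_loops[OF uv] by simp
  next
    case (Cons e q)
    with p have "q \<noteq> []" by auto
    with Cons show ?thesis by (cases q) simp_all
  qed
  ultimately show False
    using assms by (auto simp: undirected_tree_def)
qed

section \<open>The upper bound\<close>

text \<open>
  \<open>E\<close> is a forest, and the tree \<open>V\<close> it induces is the core. The colors of the core vertices and of
  their feet are given by \<open>f\<close> and \<open>g\<close>.
\<close>
lemma card_colors_le:
  fixes f g :: "'a \<Rightarrow> 'c"
  assumes "sym E" "irrefl E"
    and bridge: "\<And>u v. (u, v) \<in> E \<Longrightarrow> (v, u) \<notin> (E - {(u, v), (v, u)})\<^sup>*"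
    and P2: "\<And>x y. (x, y) \<in> E \<Longrightarrow> \<not> distinct [g x, f x, f y, g y]"
    and P3: "\<And>x y z. (x, y) \<in> E \<Longrightarrow> (y, z) \<in> E \<Longrightarrow> \<not> distinct [g x, f x, f y, f z]"
  assumes "finite V" and "\<And>x y. x \<in> V \<Longrightarrow> y \<in> V \<Longrightarrow> (x, y) \<in> (E \<inter> V \<times> V)\<^sup>*"
  shows "card (f ` V \<union> g ` V) \<le> card V + 1"
  \<comment> \<open>Only finiteness and connectedness depend on \<open>V\<close>; the conditions on
    \<open>E\<close>, \<open>f\<close> and \<open>g\<close> stay fixed during the induction and hold
    for subtrees as they stand.\<close>
  using assms(6-)
proof (induction "card V" arbitrary: V rule: less_induct)
  case less
  define F where "F = E \<inter> V \<times> V"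
  define D where "D u v = F - {(u, v), (v, u)}" for u v
  \<comment> \<open>For an edge \<open>(u, v)\<close> of \<open>F\<close>, this is the side of
    \<open>u\<close> once the edge is deleted; \<open>W v u\<close> is the side of
    \<open>v\<close>.\<close>
  define W where "W u v = {x. (u, x) \<in> (D u v)\<^sup>*}" for u v
  define col where "col X = f ` X \<union> g ` X" for X
  have symE: "(y, x) \<in> E" if "(x, y) \<in> E" for x y
    using that \<open>sym E\<close> by (auto dest: symD)
  have symF: "(y, x) \<in> F" if "(x, y) \<in> F" for x y
    using that symE by (auto simp: F_def)
  have D_commute: "D v u = D u v" for u v
    by (auto simp: D_def)
  have D_sym: "sym ((D u v)\<^sup>*)" for u v
    by (rule sym_rtrancl) (auto simp: sym_def D_def symF)
  have W_sub: "W u v \<subseteq> V" if "(u, v) \<in> F" for u v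
  proof
    fix x assume "x \<in> W u v"
    then have "(u, x) \<in> (D u v)\<^sup>*" by (simp add: W_def)
    then show "x \<in> V" by (induction rule: rtrancl_induct) (use that in \<open>auto simp: F_def D_def\<close>)
  qed
  have W_disj: "W u v \<inter> W v u = {}" if "(u, v) \<in> F" for u v
  proof -
    have "(v, u) \<notin> (D u v)\<^sup>*"
      using bridge[of u v] that rtrancl_mono[of "D u v" "E - {(u, v), (v, u)}"]
      by (auto simp: F_def D_def)
    moreover have "(v, u) \<in> (D u v)\<^sup>*" if "(u, x) \<in> (D u v)\<^sup>*" "(v, x) \<in> (D u v)\<^sup>*" for x
      using that D_sym by (meson rtrancl_trans symD)
    ultimately show ?thesis
      by (auto simp: W_def D_commute)
  qed
  \<comment> \<open>On a walk from \<open>x\<close> to \<open>y\<close>, \<open>u\<close> is the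
    vertex right after the last visit to \<open>x\<close>; from there on the walk avoids the edge
    between \<open>x\<close> and \<open>u\<close>.\<close>
  have to_W: "\<exists>u. (x, u) \<in> F \<and> y \<in> W u x" if "x \<in> V" "y \<in> V" "x \<noteq> y" for x y
  proof -
    have "(x, y) \<in> F\<^sup>*"
      using less.prems(2) that by (simp add: F_def)
    then have "x = y \<or> (\<exists>u. (x, u) \<in> F \<and> (u, y) \<in> (D u x)\<^sup>*)"
    proof (induction rule: rtrancl_induct)
      case (step y z)
      show ?case
      proof (cases "x = y \<or> x = z")
        case False
        with step.IH obtain u where u: "(x, u) \<in> F" "(u, y) \<in> (D u x)\<^sup>*" by blast
        moreover have "(y, z) \<in> D u x" using step.hyps False by (auto simp: D_def)
        ultimately show ?thesis by (meson rtrancl.rtrancl_into_rtrancl)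
      qed (use step.hyps in blast)
    qed simp
    with that show ?thesis by (auto simp: W_def)
  qed
  show ?case
  proof (cases "\<exists>u v. (u, v) \<in> F \<and> col (W u v) \<inter> col (W v u) \<noteq> {}")
    case True
    then obtain u v where uv: "(u, v) \<in> F" and meet: "col (W u v) \<inter> col (W v u) \<noteq> {}"
      by blast
    have W_self: "a \<in> W a b" for a b
      by (simp add: W_def)
    \<comment> \<open>A walk from \<open>a\<close> that avoids the deleted edge never leaves
      \<open>W a b\<close>, so each side is connected by itself, as the induction hypothesis
      requires.\<close>
    have W_conn: "(x, y) \<in> (E \<inter> W a b \<times> W a b)\<^sup>*" if "x \<in> W a b" "y \<in> W a b" for x y a b
    proof -
      have from_a: "(a, z) \<in> (E \<inter> W a b \<times> W a b)\<^sup>*" if "z \<in> W a b" for z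
      proof -
        have "(a, z) \<in> (D a b)\<^sup>*" using that by (simp add: W_def)
        then show ?thesis
        proof (induction rule: rtrancl_induct)
          case (step y z)
          then have "y \<in> W a b" "z \<in> W a b" by (auto simp: W_def)
          with step show ?case
            by (intro rtrancl.rtrancl_into_rtrancl[OF step.IH]) (auto simp: D_def F_def)
        qed simp
      qed
      moreover have "sym ((E \<inter> W a b \<times> W a b)\<^sup>*)"
        by (rule sym_rtrancl) (auto simp: sym_def symE)
      ultimately show ?thesis using that by (meson rtrancl_trans symD)
    qed
    have vu: "(v, u) \<in> F" using symF uv .
    have fin: "finite (W u v)" "finite (W v u)"
      using W_sub uv vu less.prems(1) by (meson finite_subset)+
    have V_eq: "V = W u v \<union> W v u"
    proof
      show "W u v \<union> W v u \<subseteq> V" using W_sub uv vu by blast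
      show "V \<subseteq> W u v \<union> W v u"
      proof
        fix y assume "y \<in> V"
        then have "(u, y) \<in> F\<^sup>*" using less.prems(2) uv by (simp add: F_def)
        then show "y \<in> W u v \<union> W v u"
        proof (induction rule: rtrancl_induct)
          case base
          then show ?case using W_self by blast
        next
          case (step y z)
          show ?case
          proof (cases "(y, z) \<in> D u v")
            case True
            with step.IH show ?thesis
              by (auto simp: W_def D_commute intro: rtrancl.rtrancl_into_rtrancl)
          next
            case False
            \<comment> \<open>Only the deleted edge can switch sides, and each of its ends lies in
              its own side.\<close>
            with step.hyps have "z = u \<or> z = v" by (auto simp: D_def)
            then show ?thesis using W_self by blast
          qed
        qed
      qed
    qed
    have card_V: "card V = card (W u v) + card (W v u)"
      unfolding V_eq using W_disj[OF uv] fin by (simp add: card_Un_disjoint)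
    have pos: "card (W u v) > 0" "card (W v u) > 0"
      using W_self fin by (auto simp: card_gt_0_iff)
    have IH: "card (col (W u v)) \<le> card (W u v) + 1" "card (col (W v u)) \<le> card (W v u) + 1"
      unfolding col_def using card_V pos fin W_conn less.hyps[of "W u v"] less.hyps[of "W v u"] by simp_all
    have fin_col: "finite (col (W u v))" "finite (col (W v u))"
      using fin by (simp_all add: col_def)
    have "card (col V) + card (col (W u v) \<inter> col (W v u)) = card (col (W u v)) + card (col (W v u))"
    proof -
      have "col V = col (W u v) \<union> col (W v u)" by (subst V_eq) (auto simp: col_def)
      then show ?thesis using card_Un_Int[OF fin_col] by simp
    qed
    \<comment> \<open>The two inductive bounds add up to \<open>card V + 2\<close>; a shared color
      is counted twice and removes the surplus.\<close>
    moreover have "card (col (W u v) \<inter> col (W v u)) > 0"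
      using meet fin_col by (simp add: card_gt_0_iff)
    ultimately have "card (col V) \<le> card V + 1"
      using IH card_V by linarith
    then show ?thesis by (simp add: col_def)
  next
    case False
    \<comment> \<open>The first edge on the way from \<open>x\<close> to \<open>y\<close> separates
      them, and in this case its two sides share no color.\<close>
    have disj: "{f x, g x} \<inter> {f y, g y} = {}" if xy: "x \<in> V" "y \<in> V" "x \<noteq> y" for x y
    proof -
      from to_W[OF xy] obtain u where u: "(x, u) \<in> F" "y \<in> W u x" by blast
      then have "{f y, g y} \<subseteq> col (W u x)" by (auto simp: col_def)
      moreover have "{f x, g x} \<subseteq> col (W x u)" by (auto simp: col_def W_def)
      ultimately show ?thesis using False u by blast
    qed
    have unique: "x = y" if xy: "x \<in> V" "y \<in> V" and bi: "f x \<noteq> g x" "f y \<noteq> g y" for x y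
    proof (rule ccontr)
      assume "x \<noteq> y"
      with to_W xy obtain u where u: "(x, u) \<in> F" "y \<in> W u x" by blast
      then have uV: "u \<in> V" and xu: "(x, u) \<in> E" "x \<noteq> u"
        using \<open>irrefl E\<close> by (auto simp: F_def irrefl_def)
      show False
      proof (cases "u = y")
        case True
        then show False
          using P2[of x y] xu bi disj[OF xy] \<open>x \<noteq> y\<close> by auto
      next
        case False
        have "(u, y) \<in> (D u x)\<^sup>*" using u by (simp add: W_def)
        \<comment> \<open>As \<open>u\<close> differs from \<open>y\<close>, the walk has a further
          arc out of \<open>u\<close>; it cannot return to \<open>x\<close>, because that edge is
          deleted.\<close>
        with False obtain w where w: "(u, w) \<in> D u x"
          by (meson converse_rtranclE)
        then have "w \<in> V" "(u, w) \<in> E" "w \<noteq> x" "w \<noteq> u"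
          using \<open>irrefl E\<close> by (auto simp: D_def F_def irrefl_def)
        then show False
          using P3[of x u w] xu bi disj[of x u] disj[of x w] disj[of u w] xy uV by auto
      qed
    qed
    \<comment> \<open>Each vertex contributes one color, and a second one only if its foot differs;
      by \<open>unique\<close> this happens at most once.\<close>
    have "card (f ` V \<union> g ` V) = card (\<Union>x\<in>V. {f x, g x})"
      by (rule arg_cong[of _ _ card]) auto
    also have "\<dots> \<le> (\<Sum>x\<in>V. card {f x, g x})"
      using less.prems(1) by (rule card_UN_le)
    also have "\<dots> = (\<Sum>x\<in>V. 1 + (if f x \<noteq> g x then 1 else 0))"
      by (rule sum.cong) auto
    also have "\<dots> = card V + card {x \<in> V. f x \<noteq> g x}"
      unfolding sum.distrib using less.prems(1) by (simp add: sum.If_cases Int_def)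
    also have "card {x \<in> V. f x \<noteq> g x} \<le> 1"
      using unique less.prems(1) by (auto simp: card_le_Suc0_iff_eq)
    finally show ?thesis by simp
  qed
qed

text \<open>This is \<open>card_colors_le\<close> with \<open>f\<close> and \<open>g\<close> as the
  restrictions of \<open>c\<close> to core and feet. \<open>P2\<close> comes from paths with a foot
  at both ends, \<open>P3\<close> from those that start at a foot and continue in the core.\<close>

lemma card_colors_corona_le:
  assumes tree: "undirected_tree B" and c: "no_rainbow_P4 (corona B) c"
  shows "card (c ` pverts (corona B)) \<le> card (pverts B) + 1"
proof -
  interpret pair_graph B using tree by (simp add: undirected_tree_def)
  note paths = c[unfolded no_rainbow_P4_iff[OF pair_graph_corona[OF pair_graph_axioms]], rule_format]
  have "card ((c \<circ> Inl) ` pverts B \<union> (c \<circ> Inr) ` pverts B) \<le> card (pverts B) + 1"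
  proof (rule card_colors_le)
    show "sym (parcs B)" using pair_sym_arcs by (simp add: symmetric_def)
    show "irrefl (parcs B)" using pair_no_loops by (force simp: irrefl_def)
    show "finite (pverts B)" by simp
    have "parcs B \<inter> pverts B \<times> pverts B = parcs B"
      by (auto simp: in_arcsD1 in_arcsD2)
    then show "(x, y) \<in> (parcs B \<inter> pverts B \<times> pverts B)\<^sup>*" if "x \<in> pverts B" "y \<in> pverts B" for x y
      using that undirected_tree_connected[OF tree] by simp
    show "(v, u) \<notin> (parcs B - {(u, v), (v, u)})\<^sup>*" if "(u, v) \<in> parcs B" for u v
      using undirected_tree_bridge[OF tree that] .
    show "\<not> distinct [(c \<circ> Inr) x, (c \<circ> Inl) x, (c \<circ> Inl) y, (c \<circ> Inr) y]"
      if "(x, y) \<in> parcs B" for x y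
      using paths[of "Inr x" "Inl x" "Inl y" "Inr y"] that
      by (simp add: corona_def in_arcsD1[OF that] in_arcsD2[OF that])
    show "\<not> distinct [(c \<circ> Inr) x, (c \<circ> Inl) x, (c \<circ> Inl) y, (c \<circ> Inl) z]"
      if "(x, y) \<in> parcs B" "(y, z) \<in> parcs B" for x y z
      using paths[of "Inr x" "Inl x" "Inl y" "Inl z"] that
      by (simp add: corona_def in_arcsD1[OF that(1)])
  qed
  then show ?thesis
    by (simp add: corona_def image_Un image_comp)
qed

section \<open>The extremal coloring and the value of \<open>c4\<close>\<close>

lemma corona_coloring_exists:
  assumes "pair_graph B" "pverts B \<noteq> {}"
  shows "\<exists>c :: 'a + 'a \<Rightarrow> nat. no_rainbow_P4 (corona B) c \<and>
    card (c ` pverts (corona B)) = card (pverts B) + 1"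
proof -
  interpret pair_graph B by fact
  obtain i :: "'a \<Rightarrow> nat" where i: "inj_on i (pverts B)"
    using finite_imp_inj_to_nat_seg pair_finite_verts by metis
  \<comment> \<open>\<open>Suc\<close> keeps the colors of the feet apart from the core color
    0.\<close>
  define c :: "'a + 'a \<Rightarrow> nat" where "c = case_sum (\<lambda>_. 0) (\<lambda>w. Suc (i w))"
  \<comment> \<open>If an inner vertex of a walk is a foot, its two neighbors on the walk coincide;
    otherwise both inner vertices have color 0.\<close>
  have "no_rainbow_P4 (corona B) c"
    unfolding no_rainbow_P4_iff[OF pair_graph_corona[OF assms(1)]]
    by (auto simp: corona_def c_def)
  moreover have "c ` pverts (corona B) = insert 0 ((\<lambda>w. Suc (i w)) ` pverts B)"
    using assms(2) by (auto simp: corona_def c_def image_Un image_image)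
  moreover have "inj_on (\<lambda>w. Suc (i w)) (pverts B)"
    using i by (simp add: inj_on_def)
  ultimately show ?thesis
    by (intro exI[of _ c]) (auto simp: card_image card_insert_if)
qed

theorem theorem5:
  fixes B :: "'a pair_pre_digraph"
    and H :: "('a + 'a) pair_pre_digraph"
    and n :: nat
  assumes "undirected_tree B"
    and "H = corona B"
    and "n = card (pverts H)"
  shows "real (c4 H) = real n / 2 + 1"
proof -
  interpret pair_graph B using assms by (simp add: undirected_tree_def)
  have "pverts B \<noteq> {}"
    using assms(1) by (auto simp: undirected_tree_def connected_def strongly_connected_def mk_symmetric_def)
  then obtain c :: "'a + 'a \<Rightarrow> nat" where
    c: "no_rainbow_P4 H c" "card (c ` pverts H) = card (pverts B) + 1"
    using corona_coloring_exists[OF pair_graph_axioms] assms(2) by blast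
  have "finite (pverts H)"
    by (simp add: assms(2) corona_def)
  then have "c4 H = card (pverts B) + 1"
    unfolding c4_def using c card_colors_corona_le[OF assms(1)] assms(2)
    by (intro Max_eqI finite_c4_set) (auto intro!: exI[of _ c])
  moreover have "n = 2 * card (pverts B)"
    using assms(2,3) by (simp add: corona_def card_Plus flip: Plus_def)
  ultimately show ?thesis by simp
qed

end
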